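(* For every integer $k\geq 3$, the graph property "$G$ contains a cycle of length $k$", for graphs $G$ on the vertex set $\mathbb{N}$, is $\infty$-elusive.
   Context: Let $[\mathbb{N}]^2=\{\{n,k\}: n,k\in\mathbb{N},\ n\neq k\}$. A graph on $\mathbb{N}$ is a subset $G\subseteq[\mathbb{N}]^2$, so the set of graphs is $2^{[\mathbb{N}]^2}$. A graph property is an isomorphism-invariant subset $\mathcal{S}\subseteq 2^{[\mathbb{N}]^2}$. The game $G(\mathcal{S})$. Two players, Seeker and Hider, colour the edges of the complete graph on $\mathbb{N}$ with red, white, green. Initially all edges are white. In each turn Seeker picks a white edge and Hider recolours it green or red. The game terminates after infinitely many (that is, $\omega$ many) turns. Let $R_\infty,W_\infty,G_\infty$ be the sets of red, white and green edges at the end, and let $\mathcal{P}_\infty=\{G\subseteq[\mathbb{N}]^2: G_\infty\subseteq G\subseteq G_\infty\cup W_\infty\}$. Seeker wins if and only if $W_\infty\neq\emptyset$ and either $\mathcal{P}_\infty\subseteq\mathcal{S}$ or $\mathcal{P}_\infty\subseteq 2^{[\mathbb{N}]^2}\setminus\mathcal{S}$; otherwise Hider wins. The property $\mathcal{S}$ is $\infty$-elusive if Seeker does not have a winning strategy in $G(\mathcal{S})$. *)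

theory Defs
  imports Main
begin

type_synonym edge = "nat set"
type_synonym graph = "edge set"

definition all_edges :: "edge set" where
  "all_edges = {{m, n} |m n. m \<noteq> n}"

definition graph_property :: "graph set \<Rightarrow> bool" where
  "graph_property S \<longleftrightarrow>
     S \<subseteq> Pow all_edges \<and>
     (\<forall>f :: nat \<Rightarrow> nat. bij f \<longrightarrow> (\<forall>G \<subseteq> all_edges. G \<in> S \<longleftrightarrow> (`) f ` G \<in> S))"

text \<open>The two colours that Hider may use; an edge is white as long as it has not been picked.
  A history lists the finitely many turns played so far, each consisting of the edge picked by
  Seeker and the colour chosen by Hider; a play is an \<open>\<omega>\<close>-sequence of turns.\<close>

datatype colour = Red | Green

type_synonym turn = "edge \<times> colour"
type_synonym history = "turn list"
type_synonym play = "nat \<Rightarrow> turn"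

definition white_edges :: "history \<Rightarrow> edge set" where
  "white_edges h = all_edges - fst ` set h"

text \<open>A strategy for Seeker has to name a white edge after every list of turns, including
  those that cannot arise in play. By the next lemma this is no restriction: there is always
  a white edge left.\<close>

definition seeker_strategy :: "(history \<Rightarrow> edge) \<Rightarrow> bool" where
  "seeker_strategy \<sigma> \<longleftrightarrow> (\<forall>h. \<sigma> h \<in> white_edges h)"

lemma white_edges_nonempty: "white_edges h \<noteq> {}"
proof -
  have "inj (\<lambda>n. {0, Suc n})"
    by (auto simp: inj_on_def doubleton_eq_iff)
  then have "infinite (range (\<lambda>n. {0, Suc n}))"
    by (metis finite_imageD infinite_UNIV_nat)
  moreover have "range (\<lambda>n. {0, Suc n}) \<subseteq> all_edges"
    unfolding all_edges_def by blast
  ultimately have "infinite all_edges"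
    using finite_subset by blast
  then have "infinite (all_edges - fst ` set h)"
    by simp
  then show ?thesis
    unfolding white_edges_def by (metis finite.emptyI)
qed

definition follows :: "play \<Rightarrow> (history \<Rightarrow> edge) \<Rightarrow> bool" where
  "follows p \<sigma> \<longleftrightarrow> (\<forall>n. fst (p n) = \<sigma> (map p [0..<n]))"

definition final_red :: "play \<Rightarrow> edge set" where
  "final_red p = {fst (p n) |n. snd (p n) = Red}"

definition final_green :: "play \<Rightarrow> edge set" where
  "final_green p = {fst (p n) |n. snd (p n) = Green}"

definition final_white :: "play \<Rightarrow> edge set" where
  "final_white p = all_edges - (final_red p \<union> final_green p)"

definition final_graphs :: "play \<Rightarrow> graph set" where
  "final_graphs p =
     {G. G \<subseteq> all_edges \<and> final_green p \<subseteq> G \<and> G \<subseteq> final_green p \<union> final_white p}"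

definition seeker_wins :: "graph set \<Rightarrow> play \<Rightarrow> bool" where
  "seeker_wins S p \<longleftrightarrow>
     final_white p \<noteq> {} \<and> (final_graphs p \<subseteq> S \<or> final_graphs p \<subseteq> Pow all_edges - S)"

definition winning_strategy :: "graph set \<Rightarrow> (history \<Rightarrow> edge) \<Rightarrow> bool" where
  "winning_strategy S \<sigma> \<longleftrightarrow>
     seeker_strategy \<sigma> \<and> (\<forall>p. follows p \<sigma> \<longrightarrow> seeker_wins S p)"

definition infty_elusive :: "graph set \<Rightarrow> bool" where
  "infty_elusive S \<longleftrightarrow> \<not> (\<exists>\<sigma>. winning_strategy S \<sigma>)"

text \<open>A cycle is given by its list of distinct vertices in cyclic order; this is the usual
  notion for length at least 3.\<close>

definition is_cycle :: "graph \<Rightarrow> nat list \<Rightarrow> bool" where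
  "is_cycle G vs \<longleftrightarrow>
     length vs \<ge> 3 \<and> distinct vs \<and>
     (\<forall>i < length vs. {vs ! i, vs ! (Suc i mod length vs)} \<in> G)"

definition contains_cycle :: "nat \<Rightarrow> graph set" where
  "contains_cycle k = {G. G \<subseteq> all_edges \<and> (\<exists>vs. length vs = k \<and> is_cycle G vs)}"

lemma is_cycle_image:
  assumes "inj f" "is_cycle G vs"
  shows "is_cycle ((`) f ` G) (map f vs)"
proof -
  have "{map f vs ! i, map f vs ! (Suc i mod length vs)} \<in> (`) f ` G" if "i < length vs" for i
  proof -
    have "Suc i mod length vs < length vs"
      using that by (intro mod_less_divisor) linarith
    then have "{map f vs ! i, map f vs ! (Suc i mod length vs)}
        = f ` {vs ! i, vs ! (Suc i mod length vs)}"
      using that by simp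
    then show ?thesis
      using assms(2) that unfolding is_cycle_def by blast
  qed
  then show ?thesis
    using assms unfolding is_cycle_def by (auto simp: distinct_map inj_on_def)
qed

lemma image_all_edges:
  assumes "inj f" "G \<subseteq> all_edges"
  shows "(`) f ` G \<subseteq> all_edges"
proof
  fix e assume "e \<in> (`) f ` G"
  then obtain m n where "e = f ` {m, n}" "m \<noteq> n"
    using assms(2) unfolding all_edges_def by blast
  then show "e \<in> all_edges"
    using injD[OF assms(1), of m n] unfolding all_edges_def by auto
qed

lemma contains_cycle_image:
  assumes "inj f" "G \<in> contains_cycle k"
  shows "(`) f ` G \<in> contains_cycle k"
  using assms is_cycle_image[OF assms(1)] image_all_edges[OF assms(1)]
  unfolding contains_cycle_def by (auto intro: exI[of _ "map f _"])

lemma graph_property_contains_cycle: "graph_property (contains_cycle k)"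
  unfolding graph_property_def
proof (intro conjI allI impI iffI)
  show "contains_cycle k \<subseteq> Pow all_edges"
    unfolding contains_cycle_def by blast
next
  fix f :: "nat \<Rightarrow> nat" and G
  assume "bij f" "G \<in> contains_cycle k"
  then show "(`) f ` G \<in> contains_cycle k"
    using contains_cycle_image bij_is_inj by blast
next
  fix f :: "nat \<Rightarrow> nat" and G
  assume f: "bij f" and "(`) f ` G \<in> contains_cycle k"
  then have "(`) (inv f) ` (`) f ` G \<in> contains_cycle k"
    using contains_cycle_image bij_is_inj bij_imp_bij_inv by blast
  moreover have "(`) (inv f) ` (`) f ` G = G"
    using bij_is_inj[OF f] by (simp add: image_image)
  ultimately show "G \<in> contains_cycle k"
    by simp
qed

end

theory Submission
  imports Defs
begin

text \<open>
  Whatever Seeker does, Hider can defend as follows. Hider keeps a nonempty set \<open>T\<close> of white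
  edges that is minimal with the property that turning all of \<open>T\<close> green would create a
  \<open>k\<close>-cycle; in particular the green graph has no \<open>k\<close>-cycle. An edge outside \<open>T\<close> is
  coloured red. An edge of \<open>T\<close> is coloured green and leaves \<open>T\<close>, unless it is the last edge of
  \<open>T\<close>: that one is coloured red, and Hider renews \<open>T\<close>, demanding that the new \<open>T\<close> contains a
  white edge of least rank; the rank of an edge is its larger end vertex, so that only finitely
  many edges have rank at most a given number.

  A renewal is always possible (\<open>completing_exists\<close>). If the demanded edge \<open>e\<close> already closes a
  \<open>k\<close>-cycle with green edges, \<open>{e}\<close> will do. Otherwise a \<open>k\<close>-cycle through \<open>e\<close> and
  \<open>k - 2\<close> untouched vertices will do: the untouched vertices have no other edges, so a
  \<open>k\<close>-cycle that meets one of them must run through the whole new cycle.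

  Suppose that some edge stays white forever. If \<open>T\<close> is renewed only finitely often, then the
  green edges together with \<open>T\<close> eventually form a constant graph; it contains a \<open>k\<close>-cycle and
  none of its edges is ever red, while the green edges alone never contain a \<open>k\<close>-cycle. So
  Seeker does not win. Infinitely many renewals are impossible: a late renewal demands an edge
  that stays white forever, and such an edge never leaves \<open>T\<close>, so \<open>T\<close> is never renewed again.
\<close>

section \<open>Cycles in graphs\<close>

definition has_cycle :: "nat \<Rightarrow> graph \<Rightarrow> bool" where
  "has_cycle k G \<longleftrightarrow> (\<exists>vs. length vs = k \<and> is_cycle G vs)"

lemma has_cycle_mono: "has_cycle k G \<Longrightarrow> G \<subseteq> H \<Longrightarrow> has_cycle k H"
  unfolding has_cycle_def is_cycle_def by blast

lemma has_cycle_finite: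
  assumes "has_cycle k G"
  obtains E where "finite E" "E \<subseteq> G" "has_cycle k E"
proof -
  obtain vs where vs: "length vs = k" "is_cycle G vs"
    using assms unfolding has_cycle_def by blast
  let ?E = "(\<lambda>i. {vs ! i, vs ! (Suc i mod length vs)}) ` {..<length vs}"
  have "finite ?E" "?E \<subseteq> G" "is_cycle ?E vs"
    using vs unfolding is_cycle_def by auto
  then show thesis
    using that vs(1) unfolding has_cycle_def by blast
qed

lemma finite_subset_UN_incseq:
  fixes A :: "nat \<Rightarrow> 'a set"
  assumes "mono A" "finite E" "E \<subseteq> (\<Union>n. A n)"
  shows "\<exists>n. E \<subseteq> A n"
  using assms(2,3)
proof (induction E rule: finite_induct)
  case (insert x E)
  then obtain m n where "E \<subseteq> A m" "x \<in> A n"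
    by auto
  then have "insert x E \<subseteq> A (max m n)"
    using monoD[OF assms(1), of m "max m n"] monoD[OF assms(1), of n "max m n"] by auto
  then show ?case
    by blast
qed simp

lemma is_cycle_two_neighbours:
  assumes "is_cycle G vs" "x \<in> set vs"
  obtains y z where "y \<in> set vs" "z \<in> set vs" "y \<noteq> z" "y \<noteq> x" "z \<noteq> x"
    "{x, y} \<in> G" "{x, z} \<in> G"
proof -
  let ?n = "length vs"
  have n: "3 \<le> ?n" and d: "distinct vs"
    and e: "\<And>i. i < ?n \<Longrightarrow> {vs ! i, vs ! (Suc i mod ?n)} \<in> G"
    using assms(1) unfolding is_cycle_def by auto
  obtain i where i: "i < ?n" "vs ! i = x"
    using assms(2) by (metis in_set_conv_nth)
  define a where "a = (if Suc i = ?n then 0 else Suc i)"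
  define b where "b = (if i = 0 then ?n - 1 else i - 1)"
  have a: "a < ?n" "Suc i mod ?n = a" and b: "b < ?n" "Suc b mod ?n = i"
    using i(1) n unfolding a_def b_def by auto
  have ne: "a \<noteq> b" "a \<noteq> i" "b \<noteq> i"
    using i(1) n unfolding a_def b_def by (auto split: if_splits)
  show thesis
  proof (rule that)
    show "vs ! a \<in> set vs" "vs ! b \<in> set vs"
      using a b by auto
    show "vs ! a \<noteq> vs ! b" "vs ! a \<noteq> x" "vs ! b \<noteq> x"
      using d a b i ne by (auto simp: nth_eq_iff_index_eq)
    show "{x, vs ! a} \<in> G"
      using e[OF i(1)] a i by simp
    show "{x, vs ! b} \<in> G"
      using e[OF b(1)] b i by (simp add: insert_commute)
  qed
qed

section \<open>Minimal completions of a graph to one with a cycle\<close>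

definition completing :: "nat \<Rightarrow> graph \<Rightarrow> edge set \<Rightarrow> bool" where
  "completing k F T \<longleftrightarrow>
     T \<noteq> {} \<and> has_cycle k (F \<union> T) \<and> (\<forall>X. X \<subset> T \<longrightarrow> \<not> has_cycle k (F \<union> X))"

lemma completing_not_has_cycle: "completing k F T \<Longrightarrow> \<not> has_cycle k F"
  unfolding completing_def by (metis psubsetI empty_subsetI sup_bot_right)

lemma completing_insert:
  assumes "completing k F T" "e \<in> T" "T \<noteq> {e}"
  shows "completing k (insert e F) (T - {e})"
  unfolding completing_def
proof (intro conjI allI impI)
  show "T - {e} \<noteq> {}"
    using assms by blast
  have "insert e F \<union> (T - {e}) = F \<union> T"
    using assms(2) by blast
  then show "has_cycle k (insert e F \<union> (T - {e}))"
    using assms(1) unfolding completing_def by simp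
  fix X assume "X \<subset> T - {e}"
  then have "insert e X \<subset> T"
    using assms(2) by blast
  then show "\<not> has_cycle k (insert e F \<union> X)"
    using assms(1) unfolding completing_def by (metis Un_insert_left Un_insert_right)
qed

definition cycle_edges :: "nat list \<Rightarrow> edge set" where
  "cycle_edges cs = (\<lambda>i. {cs ! i, cs ! (Suc i mod length cs)}) ` {..<length cs}"

text \<open>The inner vertices of the list \<open>cs\<close> have degree 2 in \<open>F \<union> cycle_edges cs\<close>. A cycle through
  one of them therefore passes through its two neighbours on \<open>cs\<close> and, step by step, through
  all of \<open>cs\<close>. Having the same length as \<open>cs\<close>, it has no other vertices; so the end vertex
  \<open>cs ! 0\<close> finds its second neighbour only in the other end vertex, and the closing edge is used
  as well.\<close>

lemma cycle_through_fresh_vertex: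
  assumes cs: "distinct cs" "3 \<le> length cs"
    and fresh: "\<And>i f. 0 < i \<Longrightarrow> Suc i < length cs \<Longrightarrow> f \<in> F \<Longrightarrow> cs ! i \<notin> f"
    and H: "H \<subseteq> F \<union> cycle_edges cs"
    and vs: "is_cycle H vs" "length vs = length cs"
    and i: "0 < i" "Suc i < length cs" "cs ! i \<in> set vs"
  shows "cycle_edges cs \<subseteq> H"
proof -
  let ?n = "length cs"
  have nbr: "y = cs ! (j - 1) \<or> y = cs ! Suc j"
    if j: "0 < j" "Suc j < ?n" and y: "{cs ! j, y} \<in> H" for j y
  proof -
    have "{cs ! j, y} \<in> cycle_edges cs"
      using y H fresh[OF j] by blast
    then obtain l where l: "l < ?n" "{cs ! j, y} = {cs ! l, cs ! (Suc l mod ?n)}"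
      unfolding cycle_edges_def by auto
    have l': "Suc l mod ?n < ?n"
      using l(1) by (intro mod_less_divisor) linarith
    consider "cs ! j = cs ! l" "y = cs ! (Suc l mod ?n)"
      | "cs ! j = cs ! (Suc l mod ?n)" "y = cs ! l"
      using l(2) by (auto simp: doubleton_eq_iff)
    then show ?thesis
    proof cases
      case 1
      then have "j = l"
        using cs(1) j l(1) by (simp add: nth_eq_iff_index_eq)
      then show ?thesis
        using 1 j by simp
    next
      case 2
      then have "j = Suc l mod ?n"
        using cs(1) j l' by (simp add: nth_eq_iff_index_eq)
      then have "j = Suc l"
        using j l(1) by (cases "Suc l = ?n") auto
      then show ?thesis
        using 2 by simp
    qed
  qed
  have both: "cs ! (j - 1) \<in> set vs \<and> cs ! Suc j \<in> set vs \<and>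
      {cs ! j, cs ! (j - 1)} \<in> H \<and> {cs ! j, cs ! Suc j} \<in> H"
    if j: "0 < j" "Suc j < ?n" "cs ! j \<in> set vs" for j
  proof -
    obtain y z where yz: "y \<in> set vs" "z \<in> set vs" "y \<noteq> z" "{cs ! j, y} \<in> H" "{cs ! j, z} \<in> H"
      using is_cycle_two_neighbours[OF vs(1) j(3)] by blast
    show ?thesis
      using nbr[OF j(1,2) yz(4)] nbr[OF j(1,2) yz(5)] yz by auto
  qed
  have up: "i \<le> j \<Longrightarrow> j < ?n \<Longrightarrow> cs ! j \<in> set vs" for j
  proof (induction j rule: dec_induct)
    case (step j)
    then show ?case
      using both[of j] i by simp
  qed (use i in simp)
  have down: "j \<le> i \<Longrightarrow> cs ! j \<in> set vs" for j
  proof (induction j rule: inc_induct)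
    case (step j)
    then show ?case
      using both[of "Suc j"] i by simp
  qed (use i in simp)
  have all: "cs ! j \<in> set vs" if "j < ?n" for j
    using up down that nat_le_linear by blast
  then have "set cs \<subseteq> set vs"
    by (auto simp: in_set_conv_nth)
  moreover have "card (set cs) = card (set vs)"
    using cs(1) vs unfolding is_cycle_def by (simp add: distinct_card)
  ultimately have S: "set cs = set vs"
    by (intro card_subset_eq) auto
  \<comment> \<open>The vertex \<open>cs ! 0\<close> is not fresh, so its neighbours are restricted only by \<open>S\<close>: each lies on
    \<open>cs\<close>, and a fresh one must be \<open>cs ! 1\<close>.\<close>
  have last: "{cs ! 0, cs ! (?n - 1)} \<in> H"
  proof -
    have "cs ! 0 \<in> set vs"
      using all[of 0] cs(2) by linarith
    then obtain y where y: "y \<in> set vs" "y \<noteq> cs ! 0" "y \<noteq> cs ! 1" "{cs ! 0, y} \<in> H"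
      using is_cycle_two_neighbours[OF vs(1)] by metis
    then obtain j where j: "j < ?n" "y = cs ! j"
      using S by (metis in_set_conv_nth)
    have j01: "j \<noteq> 0" "j \<noteq> 1"
      using y(2,3) j(2) by metis+
    have "\<not> Suc j < ?n"
    proof
      assume s: "Suc j < ?n"
      then have "cs ! 0 = cs ! (j - 1) \<or> cs ! 0 = cs ! Suc j"
        using nbr[of j "cs ! 0"] j01 y j by (simp add: insert_commute)
      moreover have "0 < ?n" "j - 1 < ?n"
        using s by auto
      ultimately have "j - 1 = 0"
        using cs(1) s by (simp only: nth_eq_iff_index_eq) simp
      then show False
        using j01 by simp
    qed
    then have "j = ?n - 1"
      using j by simp
    then show ?thesis
      using y j by simp
  qed
  show ?thesis
  proof
    fix f assume "f \<in> cycle_edges cs"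
    then obtain l where l: "l < ?n" "f = {cs ! l, cs ! (Suc l mod ?n)}"
      unfolding cycle_edges_def by auto
    consider "Suc l = ?n" | "0 < l" "Suc l < ?n" | "l = 0"
      using l(1) by linarith
    then show "f \<in> H"
    proof cases
      case 1
      then have "l = ?n - 1" "Suc l mod ?n = 0"
        by auto
      then show ?thesis
        using l last by (simp add: insert_commute)
    next
      case 2
      then show ?thesis
        using both[of l] all[of l] l by simp
    next
      case 3
      then show ?thesis
        using both[of 1] all[of 1] l cs(2) by (simp add: insert_commute)
    qed
  qed
qed

lemma fresh_cycle_completing:
  assumes xs: "distinct xs" "xs \<noteq> []" "u \<noteq> v" "u \<notin> set xs" "v \<notin> set xs"
    and fresh: "\<And>x f. x \<in> set xs \<Longrightarrow> f \<in> F \<Longrightarrow> x \<notin> f"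
    and uv: "{u, v} \<notin> F" "\<not> has_cycle (length xs + 2) (insert {u, v} F)"
  defines "cs \<equiv> u # xs @ [v]"
  shows "completing (length xs + 2) F (cycle_edges cs)"
  unfolding completing_def
proof (intro conjI allI impI notI)
  let ?n = "length cs"
  have n: "?n = length xs + 2" "3 \<le> ?n"
    using xs(2) unfolding cs_def by (cases xs, auto)+
  have d: "distinct cs"
    using xs unfolding cs_def by auto
  have inner: "cs ! i \<in> set xs" if "0 < i" "Suc i < ?n" for i
    using that unfolding cs_def by (cases i) (auto simp: nth_append)
  have ends: "cs ! 0 = u" "cs ! (?n - 1) = v"
    unfolding cs_def by (auto simp: nth_append)
  have inner_iff: "\<exists>i. 0 < i \<and> Suc i < ?n \<and> cs ! i = x" if x: "x \<in> set xs" for x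
  proof -
    obtain i where "i < length xs" "xs ! i = x"
      using x by (metis in_set_conv_nth)
    then have "cs ! Suc i = x" "Suc (Suc i) < ?n"
      unfolding cs_def by (auto simp: nth_append)
    then show ?thesis
      by blast
  qed
  have edge: "f = {u, v} \<or> (\<exists>x\<in>set xs. x \<in> f)" if f: "f \<in> cycle_edges cs" for f
  proof -
    obtain l where l: "l < ?n" "f = {cs ! l, cs ! (Suc l mod ?n)}"
      using f unfolding cycle_edges_def by auto
    consider "Suc l = ?n" | "0 < l" "Suc l < ?n" | "l = 0" "Suc 1 < ?n"
      using l(1) n by linarith
    then show ?thesis
    proof cases
      case 1
      then have "l = ?n - 1" "Suc l mod ?n = 0"
        by auto
      then show ?thesis
        using l ends by (simp add: insert_commute)
    next
      case 2
      then show ?thesis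
        using inner[of l] l by auto
    next
      case 3
      then show ?thesis
        using inner[of 1] l by auto
    qed
  qed
  show "cycle_edges cs = {} \<Longrightarrow> False"
    using n unfolding cycle_edges_def by auto
  have "is_cycle (F \<union> cycle_edges cs) cs"
    using n d unfolding is_cycle_def cycle_edges_def by auto
  then show "has_cycle (length xs + 2) (F \<union> cycle_edges cs)"
    using n unfolding has_cycle_def by auto
  fix X assume X: "X \<subset> cycle_edges cs" and "has_cycle (length xs + 2) (F \<union> X)"
  then obtain vs where vs: "length vs = ?n" "is_cycle (F \<union> X) vs"
    using n unfolding has_cycle_def by auto
  show False
  proof (cases "set vs \<inter> set xs = {}")
    case True
    have "is_cycle (insert {u, v} F) vs"
      unfolding is_cycle_def
    proof (intro conjI allI impI)
      fix i assume i: "i < length vs"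
      let ?f = "{vs ! i, vs ! (Suc i mod length vs)}"
      have "Suc i mod length vs < length vs"
        using i by (intro mod_less_divisor) linarith
      then have "?f \<subseteq> set vs"
        using i by auto
      moreover have "?f \<in> F \<union> X"
        using vs(2) i unfolding is_cycle_def by blast
      ultimately show "?f \<in> insert {u, v} F"
        using edge[of ?f] X True by blast
    qed (use vs in \<open>auto simp: is_cycle_def\<close>)
    then show False
      using uv(2) vs n unfolding has_cycle_def by auto
  next
    case False
    then obtain i where i: "0 < i" "Suc i < ?n" "cs ! i \<in> set vs"
      using inner_iff by blast
    have "cycle_edges cs \<subseteq> F \<union> X"
    proof (rule cycle_through_fresh_vertex[OF d n(2) _ _ vs(2) vs(1) i])
      show "cs ! i \<notin> f" if "0 < i" "Suc i < ?n" "f \<in> F" for i f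
        using fresh inner that by blast
    qed (use X in blast)
    moreover have "cycle_edges cs \<inter> F = {}"
      using edge fresh uv(1) by blast
    ultimately show False
      using X by blast
  qed
qed

lemma infinite_distinct_list:
  assumes "infinite A"
  obtains xs where "distinct xs" "length xs = n" "set xs \<subseteq> A"
proof -
  obtain B where B: "finite B" "card B = n" "B \<subseteq> A"
    using infinite_arbitrarily_large[OF assms] by blast
  then obtain xs where "set xs = B" "distinct xs"
    using finite_distinct_list by blast
  then show thesis
    using that B distinct_card by fastforce
qed

text \<open>Here \<open>A\<close> is the set of all edges coloured so far and \<open>F\<close> the set of the green ones. Only
  finitely many vertices lie on an edge of \<open>A\<close>, so there are enough untouched ones.\<close>

lemma completing_exists:
  assumes k: "3 \<le> k" and A: "finite A" "A \<subseteq> all_edges" and F: "F \<subseteq> A" "\<not> has_cycle k F"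
    and e: "e \<in> all_edges - A"
  shows "\<exists>T. completing k F T \<and> e \<in> T \<and> T \<subseteq> all_edges - A"
proof (cases "has_cycle k (insert e F)")
  case True
  have "completing k F {e}"
    using True F(2) unfolding completing_def by (auto simp: subset_singleton_iff psubset_eq)
  then show ?thesis
    using e by blast
next
  case False
  obtain u v where uv: "e = {u, v}" "u \<noteq> v"
    using e unfolding all_edges_def by auto
  have "finite (\<Union>A \<union> {u, v})"
    using A unfolding all_edges_def by auto
  then have "infinite (- (\<Union>A \<union> {u, v}))"
    by (metis finite_compl infinite_UNIV_nat)
  then obtain xs where xs: "distinct xs" "length xs = k - 2" "set xs \<subseteq> - (\<Union>A \<union> {u, v})"
    using infinite_distinct_list by metis
  have len: "length xs + 2 = k" and ne: "xs \<noteq> []"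
    using xs(2) k by auto
  define cs where "cs = u # xs @ [v]"
  have len_cs: "length cs = k"
    using len unfolding cs_def by simp
  have ends: "cs ! 0 = u" "cs ! (k - 1) = v"
    using len unfolding cs_def by (auto simp: nth_append)
  have "completing (length xs + 2) F (cycle_edges cs)"
    unfolding cs_def
    by (rule fresh_cycle_completing) (use xs ne uv e F False len in auto)
  then have "completing k F (cycle_edges cs)"
    by (simp only: len)
  moreover have "e \<in> cycle_edges cs"
  proof -
    have "Suc (k - 1) mod length cs = 0"
      using k len_cs by simp
    then have "e = {cs ! (k - 1), cs ! (Suc (k - 1) mod length cs)}"
      using ends uv by (simp add: insert_commute)
    moreover have "k - 1 < length cs"
      using k len_cs by simp
    ultimately show ?thesis
      unfolding cycle_edges_def by blast
  qed
  \<comment> \<open>Apart from \<open>e\<close>, which is white, each edge of \<open>cs\<close> has an untouched end vertex.\<close>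
  moreover have "cycle_edges cs \<subseteq> all_edges - A"
  proof
    fix f assume "f \<in> cycle_edges cs"
    then obtain i where i: "i < k" "f = {cs ! i, cs ! (Suc i mod k)}"
      using len_cs unfolding cycle_edges_def by auto
    have d: "distinct cs"
      using xs uv unfolding cs_def by auto
    have i': "Suc i mod k < k" "Suc i mod k \<noteq> i"
      using i(1) k by (auto simp: mod_Suc)
    then have "cs ! i \<noteq> cs ! (Suc i mod k)"
      using d i len_cs by (simp add: nth_eq_iff_index_eq)
    then have "f \<in> all_edges"
      using i unfolding all_edges_def by blast
    moreover have "f \<notin> A"
    proof
      assume "f \<in> A"
      then have "f \<inter> set xs = {}"
        using xs(3) by blast
      moreover have "cs ! i \<in> set cs" "cs ! (Suc i mod k) \<in> set cs"
        using i i' len_cs by auto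
      ultimately have "f \<subseteq> {u, v}"
        using i unfolding cs_def by auto
      then have "f = e"
        using \<open>cs ! i \<noteq> cs ! (Suc i mod k)\<close> i uv by auto
      then show False
        using \<open>f \<in> A\<close> e by blast
    qed
    ultimately show "f \<in> all_edges - A"
      by blast
  qed
  ultimately show ?thesis
    by blast
qed

section \<open>The strategy of Hider\<close>

definition green_edges :: "history \<Rightarrow> edge set" where
  "green_edges h = {e. (e, Green) \<in> set h}"

definition red_edges :: "history \<Rightarrow> edge set" where
  "red_edges h = {e. (e, Red) \<in> set h}"

definition first_white :: "history \<Rightarrow> edge" where
  "first_white h = (ARG_MIN Max e. e \<in> white_edges h)"

definition renewed_target :: "nat \<Rightarrow> history \<Rightarrow> edge set" where
  "renewed_target k h =
     (SOME T. completing k (green_edges h) T \<and> first_white h \<in> T \<and> T \<subseteq> white_edges h)"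

fun hider_step :: "nat \<Rightarrow> (history \<Rightarrow> edge) \<Rightarrow> history \<times> edge set \<Rightarrow> history \<times> edge set" where
  "hider_step k \<sigma> (h, T) =
     (let e = \<sigma> h in
      if e \<notin> T then (h @ [(e, Red)], T)
      else if T = {e} then (h @ [(e, Red)], renewed_target k (h @ [(e, Red)]))
      else (h @ [(e, Green)], T - {e}))"

primrec position :: "nat \<Rightarrow> (history \<Rightarrow> edge) \<Rightarrow> nat \<Rightarrow> history \<times> edge set" where
  "position k \<sigma> 0 = ([], renewed_target k [])"
| "position k \<sigma> (Suc n) = hider_step k \<sigma> (position k \<sigma> n)"

definition valid_position :: "nat \<Rightarrow> history \<times> edge set \<Rightarrow> bool" where
  "valid_position k = (\<lambda>(h, T). fst ` set h \<subseteq> all_edges \<and> green_edges h \<inter> red_edges h = {} \<and>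
     completing k (green_edges h) T \<and> T \<subseteq> white_edges h)"

lemma first_white: "first_white h \<in> white_edges h"
  and first_white_least: "e \<in> white_edges h \<Longrightarrow> Max (first_white h) \<le> Max e"
  using white_edges_nonempty[of h] unfolding first_white_def
  by (auto intro: arg_min_natI arg_min_nat_le)

lemma renewed_target:
  assumes "3 \<le> k" "fst ` set h \<subseteq> all_edges" "\<not> has_cycle k (green_edges h)"
  shows "completing k (green_edges h) (renewed_target k h)"
    "first_white h \<in> renewed_target k h" "renewed_target k h \<subseteq> white_edges h"
proof -
  have "green_edges h \<subseteq> fst ` set h"
    unfolding green_edges_def by force
  then have "\<exists>T. completing k (green_edges h) T \<and> first_white h \<in> T \<and> T \<subseteq> white_edges h"
    using completing_exists[of k "fst ` set h" "green_edges h" "first_white h"] assms first_white[of h]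
    unfolding white_edges_def by auto
  from someI_ex[OF this]
  show "completing k (green_edges h) (renewed_target k h)"
    "first_white h \<in> renewed_target k h" "renewed_target k h \<subseteq> white_edges h"
    unfolding renewed_target_def by blast+
qed

lemma edges_append:
  "green_edges (h @ [(e, Red)]) = green_edges h"
  "red_edges (h @ [(e, Red)]) = insert e (red_edges h)"
  "green_edges (h @ [(e, Green)]) = insert e (green_edges h)"
  "red_edges (h @ [(e, Green)]) = red_edges h"
  "white_edges (h @ [(e, c)]) = white_edges h - {e}"
  unfolding green_edges_def red_edges_def white_edges_def by auto

lemma white_not_coloured:
  "e \<in> white_edges h \<Longrightarrow> e \<in> all_edges \<and> e \<notin> green_edges h \<and> e \<notin> red_edges h"
  unfolding green_edges_def red_edges_def white_edges_def by force

lemma valid_position_step: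
  assumes k: "3 \<le> k" and \<sigma>: "seeker_strategy \<sigma>" and v: "valid_position k (h, T)"
  shows "valid_position k (hider_step k \<sigma> (h, T))"
proof -
  have e: "\<sigma> h \<in> white_edges h"
    using \<sigma> unfolding seeker_strategy_def by blast
  have h: "fst ` set h \<subseteq> all_edges" "green_edges h \<inter> red_edges h = {}"
    "completing k (green_edges h) T" "T \<subseteq> white_edges h"
    using v unfolding valid_position_def by auto
  have h': "fst ` set (h @ [(\<sigma> h, c)]) \<subseteq> all_edges" for c
    using h(1) white_not_coloured[OF e] by auto
  consider "\<sigma> h \<notin> T" | "T = {\<sigma> h}" | "\<sigma> h \<in> T" "T \<noteq> {\<sigma> h}"
    by blast
  then show ?thesis
  proof cases
    case 1
    then show ?thesis
      using h h' white_not_coloured[OF e] unfolding valid_position_def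
      by (auto simp: edges_append Let_def)
  next
    case 2
    have "\<not> has_cycle k (green_edges (h @ [(\<sigma> h, Red)]))"
      using completing_not_has_cycle[OF h(3)] by (simp add: edges_append)
    note r = renewed_target[OF k h' this]
    show ?thesis
      using 2 h h' r white_not_coloured[OF e] unfolding valid_position_def
      by (auto simp: edges_append Let_def)
  next
    case 3
    then show ?thesis
      using h h' white_not_coloured[OF e] completing_insert[OF h(3) 3] unfolding valid_position_def
      by (auto simp: edges_append Let_def)
  qed
qed

lemma valid_position:
  assumes "3 \<le> k" "seeker_strategy \<sigma>"
  shows "valid_position k (position k \<sigma> n)"
proof (induction n)
  case 0
  have "\<not> has_cycle k (green_edges [])"
    using assms(1) unfolding has_cycle_def is_cycle_def green_edges_def by force
  then show ?case
    using renewed_target[of k "[]"] assms(1) unfolding valid_position_def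
    by (auto simp: green_edges_def red_edges_def)
next
  case (Suc n)
  then show ?case
    using valid_position_step[OF assms] by (cases "position k \<sigma> n") auto
qed

section \<open>Plays against this strategy\<close>

definition hider_play :: "nat \<Rightarrow> (history \<Rightarrow> edge) \<Rightarrow> play" where
  "hider_play k \<sigma> n = last (fst (position k \<sigma> (Suc n)))"

lemma position_history:
  "fst (position k \<sigma> n) = map (hider_play k \<sigma>) [0..<n]"
  "fst (hider_play k \<sigma> n) = \<sigma> (fst (position k \<sigma> n))"
proof -
  have step: "\<exists>c. fst (position k \<sigma> (Suc n)) =
      fst (position k \<sigma> n) @ [(\<sigma> (fst (position k \<sigma> n)), c)]" for n
    by (cases "position k \<sigma> n") (auto simp: Let_def)
  show "fst (position k \<sigma> n) = map (hider_play k \<sigma>) [0..<n]"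
  proof (induction n)
    case (Suc n)
    have "fst (position k \<sigma> (Suc n)) = fst (position k \<sigma> n) @ [hider_play k \<sigma> n]"
      using step[of n] unfolding hider_play_def by auto
    then show ?case
      using Suc by simp
  qed simp
  show "fst (hider_play k \<sigma> n) = \<sigma> (fst (position k \<sigma> n))"
    using step[of n] unfolding hider_play_def by auto
qed

lemma follows_hider_play: "follows (hider_play k \<sigma>) \<sigma>"
  unfolding follows_def using position_history by metis

lemma final_edges:
  assumes "\<And>n. h n = map p [0..<n]"
  shows "final_green p = (\<Union>n. green_edges (h n))" "final_red p = (\<Union>n. red_edges (h n))"
    and "mono (\<lambda>n. green_edges (h n))" "mono (\<lambda>n. red_edges (h n))"
proof -
  have *: "(e, c) \<in> set (h n) \<longleftrightarrow> (\<exists>m<n. p m = (e, c))" for e c n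
    using assms by force
  show "final_green p = (\<Union>n. green_edges (h n))"
    unfolding final_green_def green_edges_def by (auto simp: *) (metis fst_conv lessI prod.collapse snd_conv)+
  show "final_red p = (\<Union>n. red_edges (h n))"
    unfolding final_red_def red_edges_def by (auto simp: *) (metis fst_conv lessI prod.collapse snd_conv)+
  show "mono (\<lambda>n. green_edges (h n))" "mono (\<lambda>n. red_edges (h n))"
    unfolding mono_def green_edges_def red_edges_def by (auto simp: *) (meson less_le_trans)+
qed

lemma finite_edges_Max_le: "finite {e \<in> all_edges. Max e \<le> s}"
proof (rule finite_subset)
  show "{e \<in> all_edges. Max e \<le> s} \<subseteq> Pow {..s}"
    unfolding all_edges_def by auto
qed simp

text \<open>Only finitely many edges have a larger end vertex at most \<open>Max w\<close>, so there is a turn after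
  which none of them is picked any more. The edge demanded at a later renewal is one of them; it is never picked, hence stays in the
  target, and the target cannot shrink to a last edge that is picked.\<close>

lemma finitely_many_renewals:
  assumes k: "3 \<le> k" and \<sigma>: "seeker_strategy \<sigma>"
    and w: "\<And>n. w \<in> white_edges (fst (position k \<sigma> n))"
  shows "\<exists>N. \<forall>n\<ge>N. snd (position k \<sigma> n) \<noteq> {\<sigma> (fst (position k \<sigma> n))}"
proof -
  define h where "h n = fst (position k \<sigma> n)" for n
  define T where "T n = snd (position k \<sigma> n)" for n
  have pos: "position k \<sigma> n = (h n, T n)" for n
    unfolding h_def T_def by simp
  have turn: "(h (Suc n), T (Suc n)) = hider_step k \<sigma> (h n, T n)" for n
    using position.simps(2)[of k \<sigma> n] by (simp only: pos)
  have hist: "h n = map (hider_play k \<sigma>) [0..<n]" for n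
    using position_history(1) unfolding h_def by blast
  have picked: "fst ` set (h n) = (\<lambda>m. \<sigma> (h m)) ` {..<n}" for n
    using position_history(2)[of k \<sigma>] unfolding hist[of n] h_def[symmetric] by force
  have mono_picked: "mono (\<lambda>n. fst ` set (h n))"
    unfolding picked mono_def by (auto intro: less_le_trans)
  let ?B = "{e \<in> all_edges. Max e \<le> Max w} \<inter> (\<Union>n. fst ` set (h n))"
  have "finite ?B" "?B \<subseteq> (\<Union>n. fst ` set (h n))"
    using finite_edges_Max_le[of "Max w"] by auto
  from finite_subset_UN_incseq[OF mono_picked this]
  obtain N where N: "?B \<subseteq> fst ` set (h N)"
    by blast
  show ?thesis
  proof (cases "\<forall>n\<ge>N. T n \<noteq> {\<sigma> (h n)}")
    case True
    then show ?thesis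
      unfolding h_def T_def by blast
  next
    case False
    then obtain n where n: "N \<le> n" "T n = {\<sigma> (h n)}"
      by blast
    have "valid_position k (h n, T n)"
      using valid_position[OF k \<sigma>, of n] pos by simp
    then have ncyc: "\<not> has_cycle k (green_edges (h n))"
      using completing_not_has_cycle unfolding valid_position_def by blast
    have hS: "h (Suc n) = h n @ [(\<sigma> (h n), Red)]" and TS: "T (Suc n) = renewed_target k (h (Suc n))"
      using turn[of n] n(2) by (simp_all add: Let_def)
    have "valid_position k (h (Suc n), T (Suc n))"
      using valid_position[OF k \<sigma>, of "Suc n"] by (simp only: pos)
    then have "fst ` set (h (Suc n)) \<subseteq> all_edges"
      unfolding valid_position_def by blast
    moreover have "\<not> has_cycle k (green_edges (h (Suc n)))"
      using ncyc hS by (simp add: edges_append)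
    ultimately have e: "first_white (h (Suc n)) \<in> T (Suc n)"
      using renewed_target(2)[OF k] TS by simp
    define e where "e = first_white (h (Suc n))"
    have eB: "e \<in> all_edges" "Max e \<le> Max w" "e \<notin> fst ` set (h (Suc n))"
      using first_white[of "h (Suc n)"] first_white_least[OF w[of "Suc n", folded h_def]]
      unfolding e_def white_edges_def by auto
    have "fst ` set (h N) \<subseteq> fst ` set (h (Suc n))"
      using n(1) by (intro monoD[OF mono_picked]) simp
    then have "e \<notin> ?B"
      using eB(3) N by (meson subsetD)
    then have unpicked: "e \<notin> fst ` set (h m)" for m
      using eB(1,2) by simp
    have never: "\<sigma> (h m) \<noteq> e" for m
    proof -
      have "\<sigma> (h m) \<in> fst ` set (h (Suc m))"
        unfolding picked by simp
      then show ?thesis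
        using unpicked by metis
    qed
    have "e \<in> T m" if "Suc n \<le> m" for m
      using that
    proof (induction m rule: dec_induct)
      case (step m)
      then have "T m \<noteq> {\<sigma> (h m)}"
        using never[of m] by auto
      then have "T (Suc m) = T m - {\<sigma> (h m)}"
        using turn[of m] by (simp add: Let_def split: if_splits)
      then show ?case
        using step.IH never[of m] by auto
    qed (use e e_def in simp)
    then have "\<forall>m\<ge>Suc n. T m \<noteq> {\<sigma> (h m)}"
      using never by (metis singletonD)
    then show ?thesis
      unfolding h_def T_def by blast
  qed
qed

text \<open>The two extreme final graphs decide the play: the green edges alone contain no \<open>k\<close>-cycle,
  since such a cycle would be green after finitely many turns, whereas green and white edges
  together contain the eventually constant graph \<open>U\<close>, which has one.\<close>

lemma hider_play_not_won:
  assumes k: "3 \<le> k" and \<sigma>: "seeker_strategy \<sigma>"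
  shows "\<not> seeker_wins (contains_cycle k) (hider_play k \<sigma>)"
proof
  let ?p = "hider_play k \<sigma>"
  assume win: "seeker_wins (contains_cycle k) ?p"
  define h where "h n = fst (position k \<sigma> n)" for n
  define T where "T n = snd (position k \<sigma> n)" for n
  have pos: "position k \<sigma> n = (h n, T n)" for n
    unfolding h_def T_def by simp
  have turn: "(h (Suc n), T (Suc n)) = hider_step k \<sigma> (h n, T n)" for n
    using position.simps(2)[of k \<sigma> n] by (simp only: pos)
  have hist: "h n = map ?p [0..<n]" for n
    using position_history(1) unfolding h_def by blast
  note fin = final_edges[of h, OF hist]
  have valid: "valid_position k (h n, T n)" for n
    using valid_position[OF k \<sigma>, of n] pos by simp
  have coloured: "fst ` set (h n) \<subseteq> all_edges" "green_edges (h n) \<inter> red_edges (h n) = {}"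
    and compl: "completing k (green_edges (h n)) (T n)"
    and white: "T n \<subseteq> white_edges (h n)" for n
    using valid[of n] unfolding valid_position_def by blast+
  have disj: "(green_edges (h n) \<union> T n) \<inter> red_edges (h n) = {}" for n
    using coloured(2)[of n] white[of n] white_not_coloured[of _ "h n"] by blast
  have "green_edges (h n) \<subseteq> all_edges" for n
    using coloured(1)[of n] unfolding green_edges_def by force
  then have in_all: "green_edges (h n) \<union> T n \<subseteq> all_edges" for n
    using white[of n] white_not_coloured[of _ "h n"] by blast
  have green_all: "final_green ?p \<subseteq> all_edges"
    using in_all fin(1) by blast
  have no_green_cycle: "\<not> has_cycle k (final_green ?p)"
  proof
    assume "has_cycle k (final_green ?p)"
    then obtain E where E: "finite E" "E \<subseteq> final_green ?p" "has_cycle k E"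
      by (rule has_cycle_finite)
    then obtain n where "E \<subseteq> green_edges (h n)"
      using finite_subset_UN_incseq[OF fin(3) E(1)] fin(1) by auto
    then show False
      using E(3) has_cycle_mono completing_not_has_cycle[OF compl] by blast
  qed
  have "final_green ?p \<in> final_graphs ?p"
    using green_all unfolding final_graphs_def by blast
  then have "final_graphs ?p \<subseteq> Pow all_edges - contains_cycle k"
    using win no_green_cycle unfolding seeker_wins_def contains_cycle_def has_cycle_def by blast
  moreover have "final_green ?p \<union> final_white ?p \<in> final_graphs ?p"
    using green_all unfolding final_graphs_def final_white_def by blast
  ultimately have no_cycle: "\<not> has_cycle k (final_green ?p \<union> final_white ?p)"
    unfolding final_graphs_def contains_cycle_def has_cycle_def by blast
  obtain w where w: "w \<in> final_white ?p"
    using win unfolding seeker_wins_def by blast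
  have "w \<in> white_edges (h n)" for n
  proof -
    have "(w, c) \<notin> set (h n)" for c
      using w fin(1,2) unfolding final_white_def green_edges_def red_edges_def by (cases c) auto
    then show ?thesis
      using w unfolding final_white_def white_edges_def by auto
  qed
  then obtain N where N: "\<forall>n\<ge>N. T n \<noteq> {\<sigma> (h n)}"
    using finitely_many_renewals[OF k \<sigma>, of w] unfolding h_def T_def by blast
  define U where "U = green_edges (h N) \<union> T N"
  \<comment> \<open>Without renewals, edges of the target only move to the green graph.\<close>
  have U: "green_edges (h n) \<union> T n = U" if "N \<le> n" for n
    using that
  proof (induction n rule: dec_induct)
    case (step n)
    have "T n \<noteq> {\<sigma> (h n)}"
      using N step.hyps by simp
    then have "green_edges (h (Suc n)) \<union> T (Suc n) = green_edges (h n) \<union> T n"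
      using turn[of n] by (cases "\<sigma> (h n) \<in> T n") (auto simp: Let_def edges_append)
    then show ?case
      using step.IH by simp
  qed (simp add: U_def)
  have "U \<inter> red_edges (h n) = {}" for n
    using disj[of "max n N"] U[of "max n N"] monoD[OF fin(4), of n "max n N"] by auto
  then have "U \<subseteq> final_green ?p \<union> final_white ?p"
    using in_all[of N] fin(2) unfolding U_def final_white_def by blast
  moreover have "has_cycle k U"
    using compl[of N] unfolding U_def completing_def by blast
  ultimately show False
    using no_cycle has_cycle_mono by blast
qed

theorem theorem3p1:
  fixes k :: nat
  assumes "k \<ge> 3"
  shows "infty_elusive (contains_cycle k)"
  unfolding infty_elusive_def winning_strategy_def
  using hider_play_not_won[OF assms] follows_hider_play by blast

end
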